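(* The spectral representation formula for reflected Brownian motion, i.e. the identity $$\frac{1}{2}\frac{1}{\sqrt{2\pi t}}\sum_{n=-\infty}^{\infty}\left(e^{-\frac{(x-y+4n)^2}{2t}}+e^{-\frac{(x+y+4n+2)^2}{2t}}\right)=\frac12\left(\frac12+\sum_{n=1}^{\infty}e^{-\frac{n^2\pi^2}{8}t}\cos\left(\frac{n\pi(x+1)}{2}\right)\cos\left(\frac{n\pi(y+1)}{2}\right)\right)$$ for all $x,y\in\mathbb{R}$ and $t>0$, implies the fourth modular identity: for all $t>0$ and $z\in\mathbb{C}$, $$\sqrt{t}\sum_{n\in\mathbb{Z}}(-1)^n e^{-\pi n^2t}\cos(2nz)=e^{-\frac{z^2}{\pi t}}\sum_{n\in\mathbb{Z}}e^{-\frac{\pi}{t}(n+\frac12)^2}\cosh\left((2n+1)\frac{z}{t}\right)=\sum_{n\in\mathbb{Z}}e^{-\frac{(z+\pi(n+\frac12))^2}{\pi t}}.$$ *)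

theory Defs
  imports "HOL-Analysis.Analysis"
begin

end

theory Submission
  imports Defs "HOL-Complex_Analysis.Complex_Analysis"
begin

text \<open>
  Setting \<open>y = -1\<close> makes the two families of images in the spectral representation coincide and
  turns the second cosine into \<open>1\<close>. The substitution \<open>x + 1 = 4 z / \<pi> + 2\<close>, with time \<open>8 t / \<pi>\<close>,
  then gives the equality of the first and third series of the modular identity for real \<open>z\<close>. Both
  are entire functions of \<open>z\<close>, so the equality extends to complex \<open>z\<close> by the identity theorem.
  Averaging the third series with its image under \<open>n \<mapsto> -1 - n\<close> produces the hyperbolic cosine.
\<close>

section \<open>Sums over the integers\<close>

text \<open>On the naturals \<open>n \<le> n^2\<close>, so the terms are dominated by the geometric
  series with ratio \<open>exp (- c)\<close>; the negative integers repeat the same values.\<close>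

lemma summable_on_gaussian_int:
  fixes c :: real
  assumes "c > 0"
  shows "(\<lambda>n::int. exp (- c * (of_int n)\<^sup>2)) summable_on UNIV"
proof -
  let ?g = "\<lambda>n::int. exp (- c * (of_int n)\<^sup>2)"
  have "summable (\<lambda>n. exp (- c) ^ n)"
    using assms by (intro summable_geometric) auto
  then have geo: "(\<lambda>n. exp (- c) ^ n) summable_on UNIV"
    by (intro norm_summable_imp_summable_on) simp
  have "norm (?g (int n)) \<le> exp (- c) ^ n" for n
  proof -
    have "real n \<le> (real n)\<^sup>2"
      by (cases n) (auto simp: power2_eq_square)
    then have "c * real n \<le> c * (real n)\<^sup>2"
      using assms by (intro mult_left_mono) auto
    then show ?thesis
      by (simp add: exp_of_nat_mult [symmetric] mult.commute)
  qed
  then have "(\<lambda>n. norm (?g (int n))) summable_on UNIV"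
    by (intro Infinite_Sum.abs_summable_on_comparison_test' [OF geo])
  then have nat: "(\<lambda>n. ?g (int n)) summable_on UNIV"
    by simp
  then have "?g summable_on range int"
    by (subst summable_on_reindex) (auto simp: o_def inj_on_def)
  moreover from nat have "?g summable_on range (\<lambda>n. - int n)"
    by (subst summable_on_reindex) (auto simp: o_def inj_on_def)
  ultimately have "?g summable_on (range int \<union> range (\<lambda>n. - int n))"
    by (rule summable_on_union)
  also have "range int \<union> range (\<lambda>n. - int n) = UNIV"
    by (auto intro: int_cases2)
  finally show ?thesis .
qed

text \<open>Folds a series over all integers into the shape of the spectral side, a constant term
  plus a series over \<open>n \<ge> 1\<close>.\<close>

lemma infsum_int_even:
  fixes h :: "int \<Rightarrow> 'a::banach"
  assumes sum: "h summable_on UNIV" and even: "\<And>n. h (- n) = h n"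
  shows "infsum h UNIV = h 0 + 2 *\<^sub>R (\<Sum>\<^sub>\<infinity>n\<in>{1::nat..}. h (int n))"
proof -
  let ?P = "int ` {1..}" and ?N = "(\<lambda>n. - int n) ` {1..}"
  have "x \<in> insert 0 (?P \<union> ?N)" for x
    by (cases x rule: int_cases3) auto
  then have U: "UNIV = insert 0 (?P \<union> ?N)"
    by auto
  have s: "h summable_on A" for A
    using sum by (rule summable_on_subset_banach) simp
  have "infsum h UNIV = h 0 + infsum h (?P \<union> ?N)"
    by (subst U, subst infsum_insert) (auto intro: s)
  also have "infsum h (?P \<union> ?N) = infsum h ?P + infsum h ?N"
    by (rule infsum_Un_disjoint) (auto intro: s)
  also have "infsum h ?P = (\<Sum>\<^sub>\<infinity>n\<in>{1::nat..}. h (int n))"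
    by (subst infsum_reindex) (auto simp: o_def inj_on_def)
  also have "infsum h ?N = (\<Sum>\<^sub>\<infinity>n\<in>{1::nat..}. h (int n))"
    by (subst infsum_reindex) (auto simp: o_def inj_on_def even)
  finally show ?thesis
    by (simp add: scaleR_2)
qed

section \<open>Series of entire functions with Gaussian majorants\<close>

text \<open>The constants may vary with the radius \<open>R\<close> but not with \<open>n\<close> or
  \<open>z\<close>: this is the uniformity on discs that the Weierstrass M-test requires.\<close>

definition gaussian_bounded :: "(int \<Rightarrow> complex \<Rightarrow> complex) \<Rightarrow> bool" where
  "gaussian_bounded f \<longleftrightarrow>
     (\<forall>R. \<exists>C c. c > 0 \<and> (\<forall>n z. norm z \<le> R \<longrightarrow> norm (f n z) \<le> C * exp (- c * (of_int n)\<^sup>2)))"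

lemma gaussian_bounded_summable:
  assumes "gaussian_bounded f"
  shows "(\<lambda>n. f n z) summable_on UNIV"
proof -
  obtain C c where "c > 0" and le: "\<And>n. norm (f n z) \<le> C * exp (- c * (of_int n)\<^sup>2)"
    using assms unfolding gaussian_bounded_def by blast
  then have "(\<lambda>n::int. C * exp (- c * (of_int n)\<^sup>2)) summable_on UNIV"
    by (intro summable_on_cmult_right summable_on_gaussian_int)
  then have "(\<lambda>n. norm (f n z)) summable_on UNIV"
    by (rule Infinite_Sum.abs_summable_on_comparison_test') (rule le)
  then show ?thesis
    by (rule abs_summable_summable)
qed

text \<open>By the M-test the finite partial sums converge uniformly on each closed disc, so the
  limit is holomorphic on the open disc; these discs cover the plane.\<close>

lemma gaussian_bounded_holomorphic:
  assumes bdd: "gaussian_bounded f" and hol: "\<And>n. f n holomorphic_on UNIV"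
  shows "(\<lambda>z. \<Sum>\<^sub>\<infinity>n. f n z) holomorphic_on UNIV"
proof -
  have "(\<lambda>z. \<Sum>\<^sub>\<infinity>n. f n z) holomorphic_on ball 0 R" for R
  proof -
    obtain C c where "c > 0"
      and le: "\<And>n z. norm z \<le> R \<Longrightarrow> norm (f n z) \<le> C * exp (- c * (of_int n)\<^sup>2)"
      using bdd unfolding gaussian_bounded_def by blast
    then have "(\<lambda>n::int. C * exp (- c * (of_int n)\<^sup>2)) summable_on UNIV"
      by (intro summable_on_cmult_right summable_on_gaussian_int)
    then have lim: "uniform_limit (cball 0 R) (\<lambda>X z. \<Sum>n\<in>X. f n z) (\<lambda>z. \<Sum>\<^sub>\<infinity>n. f n z)
        (finite_subsets_at_top UNIV)"
      by (intro Weierstrass_m_test_general) (use le in auto)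
    have hol': "(\<lambda>z. \<Sum>n\<in>X. f n z) holomorphic_on A" for X A
      by (intro holomorphic_on_sum holomorphic_on_subset [OF hol]) auto
    then have "\<forall>\<^sub>F X in finite_subsets_at_top UNIV.
        continuous_on (cball 0 R) (\<lambda>z. \<Sum>n\<in>X. f n z) \<and> (\<lambda>z. \<Sum>n\<in>X. f n z) holomorphic_on ball 0 R"
      by (intro always_eventually allI conjI holomorphic_on_imp_continuous_on)
    from holomorphic_uniform_limit [OF this lim] show ?thesis
      by simp
  qed
  then have "(\<lambda>z. \<Sum>\<^sub>\<infinity>n. f n z) holomorphic_on (\<Union>R. ball 0 R)"
    by (intro holomorphic_on_UN_open) auto
  also have "(\<Union>R. ball 0 R) = (UNIV :: complex set)"
    by (auto intro: gt_ex)
  finally show ?thesis .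
qed

text \<open>The real line accumulates at 0, so the identity theorem applies to the difference of the
  two functions.\<close>

lemma entire_eqI_real:
  assumes "f holomorphic_on UNIV" "g holomorphic_on UNIV"
    and eq: "\<And>x::real. f (of_real x) = g (of_real x)"
  shows "f z = g z"
proof -
  have "(0::complex) islimpt range of_real"
    unfolding islimpt_approachable
  proof (intro allI impI)
    fix e :: real assume "e > 0"
    then show "\<exists>x'\<in>range complex_of_real. x' \<noteq> 0 \<and> dist x' 0 < e"
      by (intro bexI [of _ "complex_of_real (e / 2)"]) (auto simp del: of_real_divide)
  qed
  then have "f z - g z = 0"
    using assms
    by (intro analytic_continuation [of "\<lambda>z. f z - g z" UNIV "range of_real" 0 z])
       (auto intro: holomorphic_intros)
  then show ?thesis by simp
qed

section \<open>Gaussian majorants for the two series\<close>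

text \<open>The cosine grows at most like \<open>exp (2 * \<bar>n\<bar> * R)\<close>. Half of the
  quadratic decay absorbs this growth, and the other half remains as the rate
  \<open>pi * t / 2\<close>.\<close>

lemma gaussian_bounded_theta4:
  fixes t :: real
  assumes "t > 0"
  shows "gaussian_bounded
    (\<lambda>n z. (-1) powi n * exp (- of_real pi * (of_int n)\<^sup>2 * of_real t) * cos (2 * of_int n * z))"
  unfolding gaussian_bounded_def
proof (intro allI exI conjI impI)
  fix R :: real and n :: int and z :: complex
  define a where "a = pi * t"
  show "pi * t / 2 > 0"
    using assms by simp
  have a: "a > 0"
    using assms by (simp add: a_def)
  assume z: "norm z \<le> R"
  let ?m = "\<bar>real_of_int n\<bar>"
  \<comment> \<open>This square is chosen so that its cross term is exactly the linear exponent
    \<open>2 * ?m * R\<close> to be absorbed.\<close>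
  have "0 \<le> (a * ?m - 2 * R)\<^sup>2 / (2 * a)"
    using a by simp
  also have "\<dots> = a / 2 * ?m\<^sup>2 - 2 * ?m * R + 2 * R\<^sup>2 / a"
    using a by (simp add: field_simps power2_eq_square)
  finally have sq: "2 * ?m * R \<le> a / 2 * ?m\<^sup>2 + 2 * R\<^sup>2 / a"
    by simp
  have "norm (cos (2 * of_int n * z)) \<le> exp (norm (2 * of_int n * z))"
    by (rule norm_cos_le)
  also have "norm (2 * of_int n * z) \<le> 2 * ?m * R"
    using z by (simp add: norm_mult mult_left_mono)
  finally have cos: "norm (cos (2 * of_int n * z)) \<le> exp (2 * ?m * R)"
    by simp
  have "norm (exp (- of_real pi * (of_int n)\<^sup>2 * of_real t) :: complex) = exp (- a * ?m\<^sup>2)"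
    by (simp add: a_def power2_eq_square mult_ac)
  then have "norm ((-1) powi n * exp (- of_real pi * (of_int n)\<^sup>2 * of_real t) * cos (2 * of_int n * z))
      = exp (- a * ?m\<^sup>2) * norm (cos (2 * of_int n * z))"
    by (simp add: norm_mult norm_power_int)
  also have "\<dots> \<le> exp (- a * ?m\<^sup>2) * exp (2 * ?m * R)"
    using cos by (intro mult_left_mono) auto
  also have "\<dots> = exp (2 * ?m * R - a * ?m\<^sup>2)"
    by (simp add: exp_add [symmetric])
  also have "\<dots> \<le> exp (2 * R\<^sup>2 / a - a / 2 * ?m\<^sup>2)"
    using sq by simp
  also have "\<dots> = exp (2 * R\<^sup>2 / a) * exp (- (pi * t / 2) * (of_int n)\<^sup>2)"
    by (simp add: exp_add [symmetric] a_def)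
  finally show "norm ((-1) powi n * exp (- of_real pi * (of_int n)\<^sup>2 * of_real t) * cos (2 * of_int n * z))
      \<le> exp (2 * R\<^sup>2 / (pi * t)) * exp (- (pi * t / 2) * (of_int n)\<^sup>2)"
    by (simp add: a_def)
qed

text \<open>The norm of the exponential depends only on the real part of its exponent, so a lower
  bound for \<open>(Re z + b)^2 - (Im z)^2\<close> that is quadratic in \<open>n\<close> suffices,
  where \<open>b = pi * (n + 1 / 2)\<close>.\<close>

lemma gaussian_bounded_shifted:
  fixes t :: real
  assumes "t > 0"
  shows "gaussian_bounded
    (\<lambda>n z. exp (- ((z + of_real pi * (of_int n + 1 / 2))\<^sup>2 / (of_real pi * of_real t))))"
  unfolding gaussian_bounded_def
proof (intro allI exI conjI impI)
  fix R :: real and n :: int and z :: complex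
  show "pi / (8 * t) > 0"
    using assms by simp
  assume z: "norm z \<le> R"
  define b where "b = pi * (real_of_int n + 1 / 2)"
  let ?w = "z + of_real pi * (of_int n + 1 / 2)"
  have w: "?w = z + of_real b"
    by (simp add: b_def)
  have "(norm z)\<^sup>2 \<le> R\<^sup>2"
    using z by (intro power_mono) auto
  then have xy: "(Re z)\<^sup>2 + (Im z)\<^sup>2 \<le> R\<^sup>2"
    by (simp add: cmod_power2)
  have n: "(real_of_int n)\<^sup>2 / 4 \<le> (real_of_int n + 1 / 2)\<^sup>2"
  proof -
    \<comment> \<open>Four times the difference of the two sides is this product. Integrality
      matters: it is negative only strictly between -1 and -1/3.\<close>
    have "0 \<le> (3 * n + 1) * (n + 1)"
      by (cases "n \<ge> 0") (auto simp: zero_le_mult_iff)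
    then have "0 \<le> real_of_int ((3 * n + 1) * (n + 1))"
      by linarith
    then show ?thesis
      by (simp add: field_simps power2_eq_square)
  qed
  have "pi\<^sup>2 * ((real_of_int n)\<^sup>2 / 4) \<le> pi\<^sup>2 * (real_of_int n + 1 / 2)\<^sup>2"
    by (rule mult_left_mono [OF n]) simp
  then have b: "pi\<^sup>2 * (real_of_int n)\<^sup>2 / 8 \<le> b\<^sup>2 / 2"
    by (simp add: b_def power_mult_distrib)
  \<comment> \<open>Yields \<open>(Re z + b)^2 \<ge> b^2 / 2 - (Re z)^2\<close>, which leaves half
    of \<open>b^2\<close> for the decay.\<close>
  have "0 \<le> (2 * Re z + b)\<^sup>2 / 2"
    by simp
  also have "\<dots> = (Re z + b)\<^sup>2 + (Re z)\<^sup>2 - b\<^sup>2 / 2"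
    by (simp add: power2_eq_square field_simps)
  finally have "pi\<^sup>2 * (real_of_int n)\<^sup>2 / 8 - R\<^sup>2 \<le> (Re z + b)\<^sup>2 - (Im z)\<^sup>2"
    using b xy by linarith
  also have "\<dots> = Re (?w\<^sup>2)"
    unfolding w by (simp add: power2_eq_square)
  finally have "(pi\<^sup>2 * (real_of_int n)\<^sup>2 / 8 - R\<^sup>2) / (pi * t) \<le> Re (?w\<^sup>2) / (pi * t)"
    using assms by (intro divide_right_mono) auto
  also have "Re (?w\<^sup>2) / (pi * t) = Re (?w\<^sup>2 / (of_real pi * of_real t))"
    by (metis Re_divide_of_real of_real_mult)
  finally have "- Re (?w\<^sup>2 / (of_real pi * of_real t))
      \<le> R\<^sup>2 / (pi * t) + - (pi / (8 * t)) * (real_of_int n)\<^sup>2"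
    using assms by (simp add: field_simps power2_eq_square)
  then show "norm (exp (- (?w\<^sup>2 / (of_real pi * of_real t))))
      \<le> exp (R\<^sup>2 / (pi * t)) * exp (- (pi / (8 * t)) * (of_int n)\<^sup>2)"
    by (simp only: norm_exp_eq_Re exp_add [symmetric] exp_le_cancel_iff uminus_complex.sel)
qed

section \<open>From shifted Gaussians to the hyperbolic cosine\<close>

text \<open>Expanding the square separates a factor free of \<open>n\<close>, a factor even in
  \<open>n + 1 / 2\<close>, and a last factor that is inverted when \<open>n + 1 / 2\<close> changes
  sign.\<close>

lemma shifted_gaussian_expand:
  fixes t :: real and z :: complex
  assumes "t > 0"
  shows "exp (- ((z + of_real pi * (of_int n + 1 / 2))\<^sup>2 / (of_real pi * of_real t)))
    = exp (- (z\<^sup>2 / (of_real pi * of_real t)))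
      * (exp (- (of_real pi / of_real t) * (of_int n + 1 / 2)\<^sup>2)
         * exp (- ((2 * of_int n + 1) * (z / of_real t))))"
proof -
  let ?w = "of_int n + 1 / 2 :: complex"
  have "- ((z + of_real pi * ?w)\<^sup>2 / (of_real pi * of_real t))
      = - (z\<^sup>2 / (of_real pi * of_real t)) + (- (of_real pi / of_real t) * ?w\<^sup>2 + - (2 * ?w * (z / of_real t)))"
    using assms by (simp add: divide_simps) (simp add: algebra_simps power2_eq_square)
  moreover have "2 * ?w = 2 * of_int n + 1"
    by simp
  ultimately show ?thesis
    by (simp only: exp_add)
qed

lemma cosh_series_eq_shifted:
  fixes t :: real and z :: complex
  assumes "t > 0"
  defines "G \<equiv> \<lambda>n::int. exp (- ((z + of_real pi * (of_int n + 1 / 2))\<^sup>2 / (of_real pi * of_real t)))"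
    and "H \<equiv> \<lambda>n::int. exp (- (of_real pi / of_real t) * (of_int n + 1 / 2)\<^sup>2)
                  * cosh ((2 * of_int n + 1) * (z / of_real t))"
  shows "H summable_on UNIV"
    and "exp (- (z\<^sup>2 / (of_real pi * of_real t))) * infsum H UNIV = infsum G UNIV"
proof -
  define E where "E = exp (- (z\<^sup>2 / (of_real pi * of_real t)))"
  have G: "G summable_on UNIV"
    unfolding G_def by (rule gaussian_bounded_summable [OF gaussian_bounded_shifted [OF assms(1)]])
  have bij: "bij (\<lambda>n::int. -1 - n)"
    by (rule bij_betw_byWitness [of _ "\<lambda>n. -1 - n"]) auto
  have G': "(\<lambda>n. G (-1 - n)) summable_on UNIV"
    using G summable_on_reindex_bij_betw [OF bij, of G] by simp
  have inf: "(\<Sum>\<^sub>\<infinity>n. G (-1 - n)) = infsum G UNIV"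
    by (rule infsum_reindex_bij_betw [OF bij])
  \<comment> \<open>The map \<open>n\<close> to \<open>-1 - n\<close> negates
    \<open>n + 1 / 2\<close>: the Gaussian weight is kept and the two inverse exponentials add up to
    twice a \<open>cosh\<close>.\<close>
  have GH: "G n + G (-1 - n) = 2 * E * H n" for n
  proof -
    have "(of_int (-1 - n) + 1 / 2)\<^sup>2 = (of_int n + 1 / 2 :: complex)\<^sup>2"
      by (simp add: power2_eq_square algebra_simps)
    moreover have "- ((2 * of_int (-1 - n) + 1) * (z / of_real t)) = (2 * of_int n + 1) * (z / of_real t)"
      by (simp add: algebra_simps)
    ultimately show ?thesis
      unfolding G_def H_def E_def shifted_gaussian_expand [OF assms(1)]
      by (simp only:) (simp add: cosh_def scaleR_conv_of_real algebra_simps)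
  qed
  \<comment> \<open>As an exponential, \<open>E\<close> is nonzero, so summability and the value of
    the \<open>H\<close> series can be read off from \<open>G\<close>.\<close>
  then have H: "H = (\<lambda>n. inverse (2 * E) * (G n + G (-1 - n)))"
    by (auto simp: E_def field_simps)
  show "H summable_on UNIV"
    unfolding H by (intro summable_on_cmult_right summable_on_add G G')
  have "E * infsum H UNIV = E * (inverse (2 * E) * (infsum G UNIV + infsum G UNIV))"
    unfolding H by (simp only: infsum_cmult_right' infsum_add [OF G G'] inf)
  also have "\<dots> = infsum G UNIV"
    by (simp add: E_def field_simps)
  finally show "exp (- (z\<^sup>2 / (of_real pi * of_real t))) * infsum H UNIV = infsum G UNIV"
    by (simp add: E_def)
qed

section \<open>The identity for real argument\<close>

text \<open>The assumption \<open>spectral\<close> is the spectral representation at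
  \<open>y = -1\<close>, with \<open>u\<close> standing for \<open>x + 1\<close> there.\<close>

lemma theta4_real:
  fixes t x :: real
  assumes t: "t > 0"
    and spectral: "\<And>(u::real) (s::real). s > 0 \<Longrightarrow>
       1 / sqrt (2 * pi * s) * (\<Sum>\<^sub>\<infinity>n\<in>(UNIV::int set). exp (- ((u + 4 * of_int n)\<^sup>2 / (2 * s))))
       = 1 / 2 * (1 / 2 + (\<Sum>\<^sub>\<infinity>n\<in>{1::nat..}. exp (- ((real n)\<^sup>2 * pi\<^sup>2 / 8) * s) * cos (real n * pi * u / 2)))"
  shows "of_real (sqrt t) * (\<Sum>\<^sub>\<infinity>n::int. (-1) powi n * exp (- of_real pi * (of_int n)\<^sup>2 * of_real t)
            * cos (2 * of_int n * complex_of_real x))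
       = (\<Sum>\<^sub>\<infinity>n::int. exp (- ((complex_of_real x + of_real pi * (of_int n + 1 / 2))\<^sup>2 / (of_real pi * of_real t))))"
proof -
  define h where "h = (\<lambda>n::int. exp (- pi * (real_of_int n)\<^sup>2 * t) * cos (real_of_int n * (2 * x + pi)))"
  define g where "g = (\<lambda>n::int. exp (- ((x + pi * (real_of_int n + 1 / 2))\<^sup>2 / (pi * t))))"
  \<comment> \<open>The alternating sign is a phase shift by \<open>n * pi\<close>; this is the
    source of the summand 2 in \<open>u = 4 * x / pi + 2\<close>.\<close>
  have cos: "(-1) powi n * cos (2 * real_of_int n * x) = cos (real_of_int n * (2 * x + pi))" for n :: int
    by (simp add: distrib_left cos_add mult_ac cos_int_times_real sin_int_times_real)
  have hC: "(-1) powi n * exp (- of_real pi * (of_int n)\<^sup>2 * of_real t) * cos (2 * of_int n * complex_of_real x)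
      = of_real (h n)" for n :: int
    unfolding h_def cos [symmetric] by (simp add: cos_of_real [symmetric] exp_of_real [symmetric])
  have gC: "exp (- ((complex_of_real x + of_real pi * (of_int n + 1 / 2))\<^sup>2 / (of_real pi * of_real t))) = of_real (g n)"
    for n :: int
    unfolding g_def by (simp add: exp_of_real [symmetric])
  have "(\<lambda>n. complex_of_real (h n)) summable_on UNIV"
    using gaussian_bounded_summable [OF gaussian_bounded_theta4 [OF t], of "of_real x"]
    by (simp only: hC)
  then have h: "h summable_on UNIV"
    using summable_on_Re by fastforce
  have "(\<lambda>n. complex_of_real (g n)) summable_on UNIV"
    using gaussian_bounded_summable [OF gaussian_bounded_shifted [OF t], of "of_real x"]
    by (simp only: gC)
  then have g: "g summable_on UNIV"
    using summable_on_Re by fastforce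
  have of_real_infsum: "(\<Sum>\<^sub>\<infinity>n. complex_of_real (f n)) = of_real (infsum f UNIV)"
    if "f summable_on UNIV" for f :: "int \<Rightarrow> real"
    using that by (intro infsumI has_sum_of_real has_sum_infsum)
  from h have hsum: "infsum h UNIV = 1 + 2 * (\<Sum>\<^sub>\<infinity>n\<in>{1::nat..}. h (int n))"
    by (subst infsum_int_even) (auto simp: h_def)
  \<comment> \<open>This time turns the decay \<open>n^2 * pi^2 * s / 8\<close> into
    \<open>pi * n^2 * t\<close>. On the image side \<open>u + 4 * n\<close> is \<open>4 / pi\<close>
    times \<open>x + pi * (n + 1 / 2)\<close>, and \<open>2 * s = 16 * t / pi\<close> cancels the
    factor 16.\<close>
  define s where "s = 8 * t / pi"
  have s: "s > 0"
    using t by (simp add: s_def)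
  have "(4 * x / pi + 2 + 4 * of_int n)\<^sup>2 / (2 * s) = (x + pi * (real_of_int n + 1 / 2))\<^sup>2 / (pi * t)" for n :: int
    using t by (simp add: s_def field_simps power2_eq_square)
  then have 1: "exp (- ((4 * x / pi + 2 + 4 * of_int n)\<^sup>2 / (2 * s))) = g n" for n :: int
    by (simp add: g_def)
  have 2: "exp (- ((real n)\<^sup>2 * pi\<^sup>2 / 8) * s) * cos (real n * pi * (4 * x / pi + 2) / 2) = h (int n)" for n :: nat
  proof -
    have "- ((real n)\<^sup>2 * pi\<^sup>2 / 8) * s = - pi * (real n)\<^sup>2 * t"
      by (simp add: s_def power2_eq_square)
    moreover have "real n * pi * (4 * x / pi + 2) / 2 = real n * (2 * x + pi)"
      by (simp add: field_simps)
    ultimately show ?thesis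
      by (simp only: h_def of_int_of_nat_eq)
  qed
  have "2 * pi * s = 4\<^sup>2 * t"
    by (simp add: s_def)
  then have "sqrt (2 * pi * s) = 4 * sqrt t"
    by (simp only: real_sqrt_mult [of "4\<^sup>2" t]) simp
  \<comment> \<open>With \<open>S\<close> for the series over \<open>n \<ge> 1\<close>, the spectral
    side is \<open>1 / 2 * (1 / 2 + S) = 1 / 4 * (1 + 2 * S)\<close>, a quarter of the full series
    of \<open>h\<close>.\<close>
  with spectral [OF s, of "4 * x / pi + 2"]
  have "1 / (4 * sqrt t) * infsum g UNIV = 1 / 4 * infsum h UNIV"
    by (simp only: 1 2 hsum) simp
  then have "sqrt t * infsum h UNIV = infsum g UNIV"
    using t by (simp add: field_simps)
  then show ?thesis
    unfolding hC gC of_real_infsum [OF h] of_real_infsum [OF g] by (simp flip: of_real_mult)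
qed

section \<open>The modular identity for complex argument\<close>

theorem theorem4p6:
  assumes spectral_representation:
    "\<And>(x::real) (y::real) (t::real). t > 0 \<Longrightarrow>
       1 / 2 * (1 / sqrt (2 * pi * t)) *
         (\<Sum>\<^sub>\<infinity>n\<in>(UNIV::int set).
            exp (- ((x - y + 4 * real_of_int n)^2 / (2 * t)))
            + exp (- ((x + y + 4 * real_of_int n + 2)^2 / (2 * t))))
       = 1 / 2 * (1 / 2 +
           (\<Sum>\<^sub>\<infinity>n\<in>{1::nat..}.
              exp (- ((real n)^2 * pi^2 / 8) * t)
              * cos (real n * pi * (x + 1) / 2) * cos (real n * pi * (y + 1) / 2)))"
  shows
    "\<forall>(t::real) (z::complex). t > 0 \<longrightarrow>
       (\<lambda>n::int. (-1) powi n * exp (- of_real pi * (of_int n)^2 * of_real t)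
                  * cos (2 * of_int n * z)) summable_on UNIV \<and>
       (\<lambda>n::int. exp (- (of_real pi / of_real t) * (of_int n + 1 / 2)^2)
                  * cosh ((2 * of_int n + 1) * (z / of_real t))) summable_on UNIV \<and>
       (\<lambda>n::int. exp (- ((z + of_real pi * (of_int n + 1 / 2))^2 / (of_real pi * of_real t))))
          summable_on UNIV \<and>
       of_real (sqrt t) *
         (\<Sum>\<^sub>\<infinity>n\<in>(UNIV::int set).
            (-1) powi n * exp (- of_real pi * (of_int n)^2 * of_real t) * cos (2 * of_int n * z))
       = exp (- (z^2 / (of_real pi * of_real t))) *
         (\<Sum>\<^sub>\<infinity>n\<in>(UNIV::int set).
            exp (- (of_real pi / of_real t) * (of_int n + 1 / 2)^2)
            * cosh ((2 * of_int n + 1) * (z / of_real t))) \<and>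
       exp (- (z^2 / (of_real pi * of_real t))) *
         (\<Sum>\<^sub>\<infinity>n\<in>(UNIV::int set).
            exp (- (of_real pi / of_real t) * (of_int n + 1 / 2)^2)
            * cosh ((2 * of_int n + 1) * (z / of_real t)))
       = (\<Sum>\<^sub>\<infinity>n\<in>(UNIV::int set).
            exp (- ((z + of_real pi * (of_int n + 1 / 2))^2 / (of_real pi * of_real t))))"
proof (intro allI impI, goal_cases)
  case (1 t z)
  then have t: "t > 0" .
  define A where "A = (\<lambda>(n::int) z::complex. (-1) powi n * exp (- of_real pi * (of_int n)\<^sup>2 * of_real t)
    * cos (2 * of_int n * z))"
  define G where "G = (\<lambda>(n::int) z::complex.
    exp (- ((z + of_real pi * (of_int n + 1 / 2))\<^sup>2 / (of_real pi * of_real t))))"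
  have A: "gaussian_bounded A" and G: "gaussian_bounded G"
    unfolding A_def G_def using t by (rule gaussian_bounded_theta4 gaussian_bounded_shifted)+
  \<comment> \<open>The representation is used at \<open>x - 1\<close> and \<open>-1\<close>. Each
    summand is then twice one Gaussian, which cancels the leading \<open>1 / 2\<close>.\<close>
  have spectral: "1 / sqrt (2 * pi * s) *
      (\<Sum>\<^sub>\<infinity>n\<in>(UNIV::int set). exp (- ((x + 4 * of_int n)\<^sup>2 / (2 * s))))
    = 1 / 2 * (1 / 2 + (\<Sum>\<^sub>\<infinity>n\<in>{1::nat..}.
        exp (- ((real n)\<^sup>2 * pi\<^sup>2 / 8) * s) * cos (real n * pi * x / 2)))"
    if "s > 0" for x s :: real
  proof -
    have "(x - 1) - (-1) + 4 * real_of_int n = x + 4 * of_int n"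
      "(x - 1) + (-1) + 4 * real_of_int n + 2 = x + 4 * of_int n" for n :: int
      by simp_all
    then show ?thesis
      using spectral_representation [OF that, of "x - 1" "-1"]
      by (simp add: infsum_cmult_right' flip: mult_2)
  qed
  have "A n holomorphic_on UNIV" "G n holomorphic_on UNIV" for n
    unfolding A_def G_def using t by (auto intro!: holomorphic_intros)
  then have "(\<lambda>z. of_real (sqrt t) * (\<Sum>\<^sub>\<infinity>n. A n z)) holomorphic_on UNIV"
    "(\<lambda>z. \<Sum>\<^sub>\<infinity>n. G n z) holomorphic_on UNIV"
    by (intro holomorphic_intros gaussian_bounded_holomorphic A G; simp)+
  moreover have "of_real (sqrt t) * (\<Sum>\<^sub>\<infinity>n. A n (of_real x)) = (\<Sum>\<^sub>\<infinity>n. G n (of_real x))" for x :: real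
    unfolding A_def G_def using t spectral by (rule theta4_real)
  ultimately have "of_real (sqrt t) * (\<Sum>\<^sub>\<infinity>n. A n z) = (\<Sum>\<^sub>\<infinity>n. G n z)"
    by (rule entire_eqI_real)
  \<comment> \<open>Since \<open>infsum\<close> is 0 on a family that is not summable, the
    summability facts accompany the equalities to make them statements about convergent
    series.\<close>
  with gaussian_bounded_summable [OF A, of z] gaussian_bounded_summable [OF G, of z]
    cosh_series_eq_shifted [OF t, of z]
  show ?case
    unfolding A_def G_def by (intro conjI) simp_all
qed

end
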